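(* The class of sets that are not P-rankable is not closed under join; that is, there exist sets $A, B\subseteq\Sigma^*$, neither of which is P-rankable, such that $A\oplus B$ is P-rankable.
   Context: $\Sigma=\{0,1\}$; strings are ordered in length-lexicographic order, and natural numbers are identified with strings in the standard way. For $A\subseteq\Sigma^*$, $\mathrm{rank}_A(y)=\|\{z\mid z\le y \wedge z\in A\}\|$. A (possibly partial) function $f$ is a ranking function for $A$ if $\mathrm{domain}(f)\supseteq A$ and $f(x)=\mathrm{rank}_A(x)$ for all $x\in A$ (no requirement for $x\notin A$); $A$ is P-rankable if it has a ranking function that is a total polynomial-time computable function. The join is $A\oplus B=\{x0\mid x\in A\}\cup\{x1\mid x\in B\}$. *)

theory Defs
  imports
    "HOL-Library.List_Lenlexorder"
    "HOL-Library.Finite_Map"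
    "HOL-Computational_Algebra.Polynomial"
begin

section \<open>Strings over a binary alphabet\<close>

text \<open>
  The letter 0 is \<^term>\<open>False\<close> and the letter 1 is \<^term>\<open>True\<close>. The order on lists is the
  length-lexicographic one of \<^theory>\<open>HOL-Library.List_Lenlexorder\<close>.
\<close>

type_synonym bitstring = "bool list"

lemma finite_atMost_bitstring: "finite {z. z \<le> (y :: bitstring)}"
proof (rule finite_subset)
  show "{z. z \<le> y} \<subseteq> {z. set z \<subseteq> UNIV \<and> length z \<le> length y}"
    by (auto simp: list_le_def list_less_def dest: lenlex_length)
  show "finite {z :: bitstring. set z \<subseteq> UNIV \<and> length z \<le> length y}"
    by (rule finite_lists_length_le) simp
qed

text \<open>
  The standard identification of strings with natural numbers: the empty string is 0, and
  then 0, 1, 00, 01, ... are the numbers 1, 2, 3, 4, ...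
\<close>

definition nat_of_str :: "bitstring \<Rightarrow> nat" where
  "nat_of_str x = card {z. z < x}"

lemma strict_mono_nat_of_str: "strict_mono nat_of_str"
proof (rule strict_monoI)
  fix x y :: bitstring assume "x < y"
  have "finite {z. z < y}"
    by (rule finite_subset[OF _ finite_atMost_bitstring[of y]]) auto
  moreover have "{z. z < x} \<subset> {z. z < y}"
    using \<open>x < y\<close> by (auto intro: less_trans)
  ultimately show "nat_of_str x < nat_of_str y"
    unfolding nat_of_str_def by (rule psubset_card_mono)
qed

lemma bij_nat_of_str: "bij nat_of_str"
proof (rule bijI)
  show inj: "inj nat_of_str"
    using strict_mono_nat_of_str by (rule strict_mono_imp_inj_on)
  show "surj nat_of_str"
  proof (rule ccontr)
    assume "\<not> surj nat_of_str"
    then obtain n where n: "n \<notin> range nat_of_str" by blast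
    have "infinite (range nat_of_str)"
      using inj infinite_UNIV_listI finite_imageD by blast
    then obtain x0 where "n < nat_of_str x0"
      unfolding finite_nat_set_iff_bounded_le by (auto simp: not_le)
    then obtain x where x: "n < nat_of_str x"
      and least: "\<And>y. n < nat_of_str y \<Longrightarrow> nat_of_str x \<le> nat_of_str y"
      using ex_has_least_nat[of "\<lambda>x. n < nat_of_str x" x0 nat_of_str] by blast
    have "nat_of_str z < n" if "z < x" for z
    proof -
      have "nat_of_str z < nat_of_str x"
        using strict_mono_nat_of_str that by (rule strict_monoD)
      then have "\<not> n < nat_of_str z" using least[of z] by linarith
      moreover have "nat_of_str z \<noteq> n" using n by blast
      ultimately show ?thesis by linarith
    qed
    then have "nat_of_str ` {z. z < x} \<subseteq> {..<n}" by auto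
    then have "card (nat_of_str ` {z. z < x}) \<le> card {..<n}"
      by (rule card_mono[rotated]) simp
    moreover have "card (nat_of_str ` {z. z < x}) = card {z. z < x}"
      by (rule card_image) (rule inj_on_subset[OF inj], simp)
    ultimately have "nat_of_str x \<le> n" by (simp add: nat_of_str_def)
    with x show False by simp
  qed
qed


section \<open>Polynomial-time computable functions\<close>

text \<open>
  Deterministic Turing machines with one tape that is infinite in both directions. A machine
  is the finite table of its transition function, so it mentions only finitely many states
  and tape symbols; the initial state is 0. It halts when the table has no entry for the
  current state and the scanned symbol.
\<close>

datatype symbol = Blank | Bit bool | Aux nat

datatype move = Left | Stay | Right

fun offset :: "move \<Rightarrow> int" where
  "offset Left = - 1"
| "offset Stay = 0"
| "offset Right = 1"

type_synonym tm = "(nat \<times> symbol, nat \<times> symbol \<times> move) fmap"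

type_synonym config = "nat \<times> int \<times> (int \<Rightarrow> symbol)"

fun tm_halted :: "tm \<Rightarrow> config \<Rightarrow> bool" where
  "tm_halted M (q, h, t) \<longleftrightarrow> fmlookup M (q, t h) = None"

fun tm_step :: "tm \<Rightarrow> config \<Rightarrow> config" where
  "tm_step M (q, h, t) =
    (case fmlookup M (q, t h) of
      None \<Rightarrow> (q, h, t)
    | Some (q', s, m) \<Rightarrow> (q', h + offset m, t(h := s)))"

definition tape_of :: "bitstring \<Rightarrow> int \<Rightarrow> symbol" where
  "tape_of x i = (if 0 \<le> i \<and> i < int (length x) then Bit (x ! nat i) else Blank)"

definition tm_init :: "bitstring \<Rightarrow> config" where
  "tm_init x = (0, 0, tape_of x)"

text \<open>
  The output convention mirrors the input convention: the tape contains the result and is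
  blank elsewhere, and the head scans the first cell of the result. The position of the
  result on the tape is arbitrary.
\<close>

fun tm_output :: "config \<Rightarrow> bitstring \<Rightarrow> bool" where
  "tm_output (q, h, t) y \<longleftrightarrow> (\<forall>i. t (h + i) = tape_of y i)"

definition computes_in_time :: "tm \<Rightarrow> (bitstring \<Rightarrow> bitstring) \<Rightarrow> (nat \<Rightarrow> nat) \<Rightarrow> bool" where
  "computes_in_time M f T \<longleftrightarrow>
    (\<forall>x. \<exists>k \<le> T (length x).
      let c = (tm_step M ^^ k) (tm_init x) in tm_halted M c \<and> tm_output c (f x))"

definition polytime_computable :: "(bitstring \<Rightarrow> bitstring) \<Rightarrow> bool" where
  "polytime_computable f \<longleftrightarrow> (\<exists>M (p :: nat poly). computes_in_time M f (poly p))"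


section \<open>Ranking\<close>

definition rank_of :: "bitstring set \<Rightarrow> bitstring \<Rightarrow> nat" where
  "rank_of A y = card {z. z \<le> y \<and> z \<in> A}"

definition ranking_function :: "(bitstring \<rightharpoonup> nat) \<Rightarrow> bitstring set \<Rightarrow> bool" where
  "ranking_function f A \<longleftrightarrow> A \<subseteq> dom f \<and> (\<forall>x\<in>A. f x = Some (rank_of A x))"

text \<open>
  Ranks are natural numbers, which a machine outputs as the strings identified with them.
\<close>

definition P_rankable :: "bitstring set \<Rightarrow> bool" where
  "P_rankable A \<longleftrightarrow>
    (\<exists>f. polytime_computable f \<and> ranking_function (\<lambda>x. Some (nat_of_str (f x))) A)"

definition set_join :: "bitstring set \<Rightarrow> bitstring set \<Rightarrow> bitstring set" where
  "set_join A B = {x @ [False] | x. x \<in> A} \<union> {x @ [True] | x. x \<in> B}"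

end

theory Submission
  imports Defs "HOL-Library.Countable_Set"
begin

text \<open>
  For every \<open>A\<close>, exactly one of \<open>x0\<close>, \<open>x1\<close> lies in the join of \<open>A\<close> with its complement, so the
  rank of a member \<open>xb\<close> of this join is the successor of the number of \<open>x\<close>: a machine erases the
  last letter and increments. It remains to diagonalize against the countably many polynomial-time
  functions, such that neither \<open>A\<close> nor its complement is ranked by any of them. The numbers are
  cut into blocks of four; in each block \<open>4n + 1\<close> is put into \<open>A\<close>, \<open>4n + 2\<close> is kept out,
  and exactly one of \<open>4n\<close>, \<open>4n + 3\<close> is put into \<open>A\<close>. Which one is a free choice that does not
  affect the other blocks and shifts by one the rank of \<open>4n + 1\<close> in \<open>A\<close> and of \<open>4n + 2\<close> in the
  complement.
\<close>

section \<open>Length-lexicographic order and bijective binary numeration\<close>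

text \<open>Bijective base 2: the letters 0 and 1 are the digits 1 and 2, so a longer numeral is
  always larger.\<close>

definition digit_step :: "nat \<Rightarrow> bool \<Rightarrow> nat" where
  "digit_step a b = 2 * a + (if b then 2 else 1)"

definition bij_val :: "bitstring \<Rightarrow> nat" where
  "bij_val x = foldl digit_step 0 x"

lemma bij_val_snoc: "bij_val (x @ [b]) = 2 * bij_val x + (if b then 2 else 1)"
  by (simp add: bij_val_def digit_step_def)

text \<open>Since \<open>2 * a + 2 < 2 * (a + 1) + 1\<close>, no later digit can make up for a
  prefix value that is smaller by one.\<close>

lemma foldl_digit_step_less:
  assumes "length u = length w" "a < a'"
  shows "foldl digit_step a u < foldl digit_step a' w"
  using assms
proof (induction u w arbitrary: a a' rule: list_induct2)
  case (Cons b u c w)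
  show ?case
    using Cons.IH[of "digit_step a b" "digit_step a' c"] Cons.prems
    by (simp add: digit_step_def split: if_splits)
qed simp

lemma foldl_digit_step_pos: "p \<noteq> [] \<or> 0 < a \<Longrightarrow> 0 < foldl digit_step a p"
  by (induction p arbitrary: a) (auto simp: digit_step_def)

lemma bij_val_strict_mono:
  assumes "x < y"
  shows "bij_val x < bij_val y"
proof -
  consider "length x < length y"
    | "length x = length y" "(x, y) \<in> lex {(u, v). u < v}"
    using assms by (auto simp: list_less_def lenlex_conv)
  then show ?thesis
  proof cases
    case 1
    \<comment> \<open>The tail \<open>q\<close> is as long as \<open>x\<close>; the values
      accumulated before them are 0 for \<open>x\<close> and positive for \<open>q\<close>, as
      \<open>p\<close> is nonempty.\<close>
    define p where "p = take (length y - length x) y"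
    define q where "q = drop (length y - length x) y"
    have y: "y = p @ q" and "length x = length q" and "p \<noteq> []"
      using 1 by (auto simp: p_def q_def)
    then show ?thesis
      by (simp add: bij_val_def foldl_digit_step_less foldl_digit_step_pos)
  next
    case 2
    then obtain p u w where x: "x = p @ False # u" and y: "y = p @ True # w"
      by (auto simp: lex_conv)
    then have "length u = length w"
      using 2 by simp
    then show ?thesis
      by (simp add: x y bij_val_def foldl_digit_step_less digit_step_def)
  qed
qed

lemma bij_val_less_iff: "bij_val x < bij_val y \<longleftrightarrow> x < y"
  by (metis bij_val_strict_mono less_asym linorder_neqE)

lemma bij_val_le_iff: "bij_val x \<le> bij_val y \<longleftrightarrow> x \<le> y"
  by (meson bij_val_less_iff not_le)

text \<open>The least significant letter comes first.\<close>

fun incr :: "bitstring \<Rightarrow> bitstring" where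
  "incr [] = [False]"
| "incr (True # r) = False # incr r"
| "incr (False # r) = True # r"

lemma bij_val_incr: "bij_val (rev (incr r)) = Suc (bij_val (rev r))"
  by (induction r rule: incr.induct) (simp_all add: bij_val_snoc, simp add: bij_val_def digit_step_def)

text \<open>The incremented value is the next number, so no string fits strictly between
  \<open>x\<close> and the incremented string.\<close>

lemma nat_of_str_incr: "nat_of_str (rev (incr (rev x))) = card {z. z \<le> x}"
proof -
  have "z < rev (incr (rev x)) \<longleftrightarrow> z \<le> x" for z
    by (simp add: bij_val_incr less_Suc_eq_le bij_val_le_iff flip: bij_val_less_iff)
  then show ?thesis
    by (simp add: nat_of_str_def)
qed

section \<open>A machine that erases the last letter and increments\<close>

definition cell :: "symbol list \<Rightarrow> nat \<Rightarrow> symbol" where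
  "cell xs n = (if n < length xs then xs ! n else Blank)"

text \<open>
  The tape with \<open>R\<close> written from position \<open>h\<close> rightwards and \<open>L\<close> from \<open>h - 1\<close> leftwards.
\<close>

definition split_tape :: "int \<Rightarrow> symbol list \<Rightarrow> symbol list \<Rightarrow> int \<Rightarrow> symbol" where
  "split_tape h L R i = (if h \<le> i then cell R (nat (i - h)) else cell L (nat (h - 1 - i)))"

lemma cell_simps [simp]:
  "cell [] n = Blank" "cell (s # xs) 0 = s" "cell (s # xs) (Suc n) = cell xs n"
  by (auto simp: cell_def)

lemma cell_Cons: "cell (s # xs) n = (if n = 0 then s else cell xs (n - 1))"
  by (cases n) auto

lemma split_tape_right [simp]: "split_tape h L R h = cell R 0"
  by (simp add: split_tape_def)

lemma split_tape_left [simp]: "split_tape h L R (h - 1) = cell L 0"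
  by (simp add: split_tape_def)

text \<open>Crossing a cell moves it to the other list. An empty list stands for blanks, and
  \<open>tl []\<close> is again empty.\<close>

lemma split_tape_upd_right:
  "(split_tape h L R)(h := s) = split_tape (h + 1) (s # L) (tl R)"
  by (rule ext, cases R)
    (auto simp: split_tape_def cell_Cons nat_diff_distrib algebra_simps intro!: arg_cong[where f = "cell _"])

lemma split_tape_upd_left:
  "(split_tape h L R)(h - 1 := s) = split_tape (h - 1) (tl L) (s # R)"
  by (rule ext, cases L)
    (auto simp: split_tape_def cell_Cons algebra_simps intro!: arg_cong[where f = "cell _"])

lemma split_tape_write: "(split_tape h L R)(h := s) = split_tape h L (s # tl R)"
  by (rule ext, cases R) (auto simp: split_tape_def cell_Cons)

lemma tape_of_split_tape: "tape_of x = split_tape 0 [] (map Bit x)"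
  by (rule ext) (auto simp: tape_of_def split_tape_def cell_def nat_less_iff)

text \<open>Cells that were blanked stay in the list as \<open>bs\<close> and read like the blanks
  beyond it.\<close>

lemma tm_output_split_tape:
  assumes "set bs \<subseteq> {Blank}"
  shows "tm_output (q, h, split_tape h [] (map Bit y @ bs)) y"
proof -
  have "cell (map Bit y @ bs) n = (if n < length y then Bit (y ! n) else Blank)" for n
    using assms nth_mem[of "n - length y" bs] by (fastforce simp: cell_def nth_append)
  then show ?thesis
    by (auto simp: split_tape_def tape_of_def nat_less_iff)
qed

text \<open>State 0 runs to the right end, 1 erases the last letter, 2 propagates the carry
  leftwards, 3 returns to the left end, 4 halts. On empty input the machine stops in state
  1.\<close>

definition drop_incr_tm :: tm where
  "drop_incr_tm = fmap_of_list
    [((0, Bit False), (0, Bit False, Right)),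
     ((0, Bit True), (0, Bit True, Right)),
     ((0, Blank), (1, Blank, Left)),
     ((1, Bit False), (2, Blank, Left)),
     ((1, Bit True), (2, Blank, Left)),
     ((2, Bit True), (2, Bit False, Left)),
     ((2, Bit False), (3, Bit True, Left)),
     ((2, Blank), (4, Bit False, Stay)),
     ((3, Bit False), (3, Bit False, Left)),
     ((3, Bit True), (3, Bit True, Left)),
     ((3, Blank), (4, Blank, Right))]"

lemma lookup_drop_incr_tm [simp]:
  "fmlookup drop_incr_tm (0, Bit b) = Some (0, Bit b, Right)"
  "fmlookup drop_incr_tm (0, Blank) = Some (Suc 0, Blank, Left)"
  "fmlookup drop_incr_tm (Suc 0, Bit b) = Some (2, Blank, Left)"
  "fmlookup drop_incr_tm (Suc 0, Blank) = None"
  "fmlookup drop_incr_tm (2, Bit True) = Some (2, Bit False, Left)"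
  "fmlookup drop_incr_tm (2, Bit False) = Some (3, Bit True, Left)"
  "fmlookup drop_incr_tm (2, Blank) = Some (4, Bit False, Stay)"
  "fmlookup drop_incr_tm (3, Bit b) = Some (3, Bit b, Left)"
  "fmlookup drop_incr_tm (3, Blank) = Some (4, Blank, Right)"
  "fmlookup drop_incr_tm (4, s) = None"
  by (cases b; simp add: drop_incr_tm_def fmlookup_of_list)+

lemma scan_right:
  "(tm_step drop_incr_tm ^^ length u) (0, h, split_tape h L (map Bit u)) =
    (0, h + int (length u), split_tape (h + int (length u)) (rev (map Bit u) @ L) [])"
proof (induction u arbitrary: h L)
  case (Cons b u)
  then show ?case
    by (simp add: funpow_Suc_right split_tape_upd_right algebra_simps del: funpow.simps)
qed simp

lemma scan_left:
  "\<exists>h'. (tm_step drop_incr_tm ^^ Suc (length r)) (3, h - 1, split_tape h (map Bit r) R) =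
    (4, h', split_tape h' [] (rev (map Bit r) @ R))"
proof (induction r arbitrary: h R)
  case Nil
  have "(split_tape h [] R)(h - 1 := Blank) = split_tape h [] R"
    by (rule ext) (simp add: split_tape_def)
  then show ?case
    by simp
next
  case (Cons b r)
  then show ?case
    using Cons.IH[of "h - 1" "Bit b # R"]
    by (simp add: funpow_Suc_right split_tape_upd_left algebra_simps del: funpow.simps)
qed

text \<open>The letters left of \<open>h\<close> are listed nearest first, the order that
  \<open>incr\<close> expects; its three cases are the three transitions of state 2.\<close>

lemma increment_phase:
  "\<exists>k h'. k \<le> length r + 2 \<and>
    (tm_step drop_incr_tm ^^ k) (2, h - 1, split_tape h (map Bit r) R) =
    (4, h', split_tape h' [] (rev (map Bit (incr r)) @ R))"
proof (induction r arbitrary: h R rule: incr.induct)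
  case 1
  show ?case
    by (rule exI[of _ 1], rule exI[of _ "h - 1"]) (simp add: split_tape_upd_left)
next
  case (2 r)
  obtain k h' where "k \<le> length r + 2" and
    "(tm_step drop_incr_tm ^^ k) (2, h - 1 - 1, split_tape (h - 1) (map Bit r) (Bit False # R)) =
      (4, h', split_tape h' [] (rev (map Bit (incr r)) @ Bit False # R))"
    using "2.IH"[of "h - 1" "Bit False # R"] by blast
  then show ?case
    by (intro exI[of _ "Suc k"] exI[of _ h'])
      (simp add: funpow_Suc_right split_tape_upd_left algebra_simps del: funpow.simps)
next
  case (3 r)
  obtain h' where
    "(tm_step drop_incr_tm ^^ Suc (length r))
        (3, h - 1 - 1, split_tape (h - 1) (map Bit r) (Bit True # R)) =
      (4, h', split_tape h' [] (rev (map Bit r) @ Bit True # R))"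
    using scan_left by blast
  then show ?case
    by (intro exI[of _ "Suc (Suc (length r))"] exI[of _ h'])
      (simp add: funpow_Suc_right[of "Suc (length r)"] split_tape_upd_left algebra_simps
        del: funpow.simps)
qed

definition drop_incr :: "bitstring \<Rightarrow> bitstring" where
  "drop_incr x = (if x = [] then [] else rev (incr (rev (butlast x))))"

lemma drop_incr_tm_run_snoc:
  "\<exists>k h. k \<le> 2 * length x + 5 \<and>
    (tm_step drop_incr_tm ^^ k) (tm_init (x @ [b])) =
    (4, h, split_tape h [] (map Bit (rev (incr (rev x))) @ [Blank, Blank]))"
proof -
  let ?n = "int (length x)"
  let ?step = "tm_step drop_incr_tm"
  have scan: "(?step ^^ Suc (length x)) (tm_init (x @ [b])) =
      (0, ?n + 1, split_tape (?n + 1) (Bit b # map Bit (rev x)) [])"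
    using scan_right[of "x @ [b]" 0 "[]"]
    by (simp add: tm_init_def tape_of_split_tape rev_map add.commute del: funpow.simps)
  \<comment> \<open>The two blanks that remain on the right are the cell after the input and the
    erased letter.\<close>
  have turn: "?step (0, ?n + 1, split_tape (?n + 1) (Bit b # map Bit (rev x)) []) =
      (1, ?n, split_tape (?n + 1) (Bit b # map Bit (rev x)) [Blank])"
    by (simp add: split_tape_write)
  have erase: "?step (1, ?n, split_tape (?n + 1) (Bit b # map Bit (rev x)) [Blank]) =
      (2, ?n - 1, split_tape ?n (map Bit (rev x)) [Blank, Blank])"
    using split_tape_left[of "?n + 1"] split_tape_upd_left[of "?n + 1"] by simp
  obtain k h where k: "k \<le> length (rev x) + 2" and
    incr: "(?step ^^ k) (2, ?n - 1, split_tape ?n (map Bit (rev x)) [Blank, Blank]) =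
      (4, h, split_tape h [] (rev (map Bit (incr (rev x))) @ [Blank, Blank]))"
    using increment_phase by blast
  have "(?step ^^ (k + (1 + (1 + Suc (length x))))) (tm_init (x @ [b])) =
      (4, h, split_tape h [] (rev (map Bit (incr (rev x))) @ [Blank, Blank]))"
    unfolding funpow_add o_apply scan using turn erase incr by simp
  \<comment> \<open>Scanning takes \<open>length x + 1\<close> steps, turning and erasing one each,
    incrementing at most \<open>length x + 2\<close>.\<close>
  moreover have "k + (1 + (1 + Suc (length x))) \<le> 2 * length x + 5"
    using k by simp
  ultimately show ?thesis
    by (metis rev_map)
qed

lemma computes_drop_incr: "computes_in_time drop_incr_tm drop_incr (poly [:5, 2:])"
  unfolding computes_in_time_def Let_def
proof
  fix x :: bitstring
  show "\<exists>k \<le> poly [:5, 2:] (length x).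
      tm_halted drop_incr_tm ((tm_step drop_incr_tm ^^ k) (tm_init x)) \<and>
      tm_output ((tm_step drop_incr_tm ^^ k) (tm_init x)) (drop_incr x)"
  proof (cases x rule: rev_cases)
    case Nil
    have "(tm_step drop_incr_tm ^^ 1) (tm_init x) = (1, - 1, tape_of [])"
      by (auto simp: Nil tm_init_def tape_of_def)
    then show ?thesis
      by (intro exI[of _ 1]) (simp add: Nil drop_incr_def tape_of_def)
  next
    case (snoc w b)
    obtain k h where k: "k \<le> 2 * length w + 5" and
      run: "(tm_step drop_incr_tm ^^ k) (tm_init x) =
        (4, h, split_tape h [] (map Bit (drop_incr x) @ [Blank, Blank]))"
      using drop_incr_tm_run_snoc[of w b] by (auto simp: snoc drop_incr_def)
    have "tm_output (4, h, split_tape h [] (map Bit (drop_incr x) @ [Blank, Blank])) (drop_incr x)"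
      by (rule tm_output_split_tape) simp
    moreover have "k \<le> poly [:5, 2:] (length x)"
      using k by (simp add: snoc)
    ultimately show ?thesis
      by (intro exI[of _ k]) (simp add: run del: tm_output.simps)
  qed
qed

lemma polytime_drop_incr: "polytime_computable drop_incr"
  unfolding polytime_computable_def using computes_drop_incr by blast

section \<open>The join of a set with its complement\<close>

lemma mem_set_join_Compl: "x @ [b] \<in> set_join A (- A) \<longleftrightarrow> b = (x \<notin> A)"
  by (auto simp: set_join_def)

text \<open>Appending to each string the one letter that puts it into the join lists the join in
  increasing order.\<close>

lemma rank_of_set_join_Compl:
  assumes "x @ [b] \<in> set_join A (- A)"
  shows "rank_of (set_join A (- A)) (x @ [b]) = card {z. z \<le> x}"
proof -
  define f where "f z = z @ [z \<notin> A]" for z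
  have b: "b = (x \<notin> A)"
    using assms by (simp add: mem_set_join_Compl)
  have f_le: "f z \<le> x @ [b] \<longleftrightarrow> z \<le> x" for z
  proof (cases "z = x")
    case False
    \<comment> \<open>Values that differ by at least one outweigh, after doubling, the last digits,
      which differ by at most one.\<close>
    then have "bij_val z \<noteq> bij_val x"
      by (metis bij_val_le_iff order_antisym order_refl)
    then show ?thesis
      by (auto simp: f_def bij_val_snoc simp flip: bij_val_le_iff)
  qed (simp add: f_def b)
  have "set_join A (- A) = range f"
    by (auto simp: set_join_def f_def)
  then have "{z. z \<le> x @ [b] \<and> z \<in> set_join A (- A)} = f ` {z. z \<le> x}"
    using f_le by auto
  moreover have "inj f"
    by (auto simp: inj_def f_def)
  ultimately show ?thesis
    by (simp add: rank_of_def card_image inj_on_subset)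
qed

lemma P_rankable_set_join_Compl: "P_rankable (set_join A (- A))"
  unfolding P_rankable_def ranking_function_def
proof (intro exI conjI ballI)
  fix y assume y: "y \<in> set_join A (- A)"
  then obtain x b where "y = x @ [b]"
    by (auto simp: set_join_def)
  with y show "Some (nat_of_str (drop_incr y)) = Some (rank_of (set_join A (- A)) y)"
    by (simp add: drop_incr_def nat_of_str_incr rank_of_set_join_Compl)
qed (simp_all add: polytime_drop_incr dom_def)

section \<open>Countably many polynomial-time functions\<close>

instance symbol :: countable by countable_datatype

instance move :: countable by countable_datatype

lemma funpow_tm_step_halted: "tm_halted M c \<Longrightarrow> (tm_step M ^^ k) c = c"
  by (induction k) (cases c; simp)+

text \<open>Halting configurations are fixed by \<open>tm_step\<close>, so both runs agree after
  \<open>k + l\<close> steps.\<close>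

lemma tm_halting_config_unique:
  assumes "tm_halted M ((tm_step M ^^ k) c)" "tm_halted M ((tm_step M ^^ l) c)"
  shows "(tm_step M ^^ k) c = (tm_step M ^^ l) c"
proof -
  have "(tm_step M ^^ (l + k)) c = (tm_step M ^^ k) c"
    "(tm_step M ^^ (k + l)) c = (tm_step M ^^ l) c"
    unfolding funpow_add o_apply using assms by (simp_all add: funpow_tm_step_halted)
  then show ?thesis
    by (simp add: add.commute)
qed

lemma tape_of_inject: "tape_of x = tape_of y \<Longrightarrow> x = y"
proof (rule nth_equalityI)
  assume eq: "tape_of x = tape_of y"
  have "i < length x \<longleftrightarrow> i < length y" for i
    using fun_cong[OF eq, of "int i"] by (auto simp: tape_of_def split: if_splits)
  then show len: "length x = length y"
    by (metis nat_neq_iff)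
  fix i assume "i < length x"
  then show "x ! i = y ! i"
    using fun_cong[OF eq, of "int i"] len by (simp add: tape_of_def)
qed

lemma tm_output_unique: "tm_output c x \<Longrightarrow> tm_output c y \<Longrightarrow> x = y"
  by (cases c) (auto intro!: tape_of_inject)

lemma computes_in_time_unique:
  assumes "computes_in_time M f T" "computes_in_time M g S"
  shows "f = g"
proof
  fix x
  show "f x = g x"
    using assms unfolding computes_in_time_def Let_def
    by (metis tm_halting_config_unique tm_output_unique)
qed

lemma countable_polytime_computable: "countable {f. polytime_computable f}"
proof (rule countable_subset)
  \<comment> \<open>A machine determines the function it computes, so \<open>THE\<close> recovers
    it; for a machine that computes none it is an arbitrary value.\<close>
  show "{f. polytime_computable f} \<subseteq> range (\<lambda>M. THE f. \<exists>T. computes_in_time M f T)"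
  proof
    fix f assume "f \<in> {f. polytime_computable f}"
    then obtain M T where "computes_in_time M f T"
      by (auto simp: polytime_computable_def)
    then have "f = (THE f. \<exists>T. computes_in_time M f T)"
      by (intro the_equality[symmetric]) (auto intro: computes_in_time_unique)
    then show "f \<in> range (\<lambda>M. THE f. \<exists>T. computes_in_time M f T)"
      by blast
  qed
qed simp

section \<open>Diagonalization\<close>

definition block_mem :: "(nat \<Rightarrow> bool) \<Rightarrow> nat \<Rightarrow> bool" where
  "block_mem c m \<longleftrightarrow>
    m mod 4 = 0 \<and> c (m div 4) \<or> m mod 4 = 1 \<or> m mod 4 = 3 \<and> \<not> c (m div 4)"

lemma block_mem_simps [simp]:
  "block_mem c (4 * n) = c n"
  "block_mem c (Suc (4 * n))"
  "\<not> block_mem c (Suc (Suc (4 * n)))"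
  "block_mem c (Suc (Suc (Suc (4 * n)))) \<longleftrightarrow> \<not> c n"
  unfolding block_mem_def by (presburger | simp add: mod_Suc div_Suc)+

text \<open>Whatever \<open>c\<close> chooses, each block has two members and two non-members, so
  ranks in a block do not depend on earlier choices.\<close>

lemma count_block_mem:
  "(\<Sum>m<4 * n. of_bool (block_mem c m)) = 2 * n"
  "(\<Sum>m<4 * n. of_bool (\<not> block_mem c m)) = 2 * n"
proof -
  have "4 * Suc n = Suc (Suc (Suc (Suc (4 * n))))" for n :: nat
    by simp
  then show "(\<Sum>m<4 * n. of_bool (block_mem c m)) = 2 * n"
    "(\<Sum>m<4 * n. of_bool (\<not> block_mem c m)) = 2 * n"
    by (induction n) (simp_all only: sum.lessThan_Suc block_mem_simps, simp_all)
qed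

text \<open>As \<open>nat_of_str\<close> is an order isomorphism onto the numbers, ranks may be
  counted there.\<close>

lemma rank_of_numbered:
  "rank_of {x. P (nat_of_str x)} y = (\<Sum>m<Suc (nat_of_str y). of_bool (P m))"
proof -
  have "nat_of_str ` {z. z \<le> y \<and> P (nat_of_str z)} = {..<Suc (nat_of_str y)} \<inter> {m. P m}"
    using bij_is_surj[OF bij_nat_of_str]
    by (auto simp: strict_mono_less_eq[OF strict_mono_nat_of_str] less_Suc_eq_le image_iff)
      (metis strict_mono_less_eq[OF strict_mono_nat_of_str] surjD)
  then have "card {z. z \<le> y \<and> P (nat_of_str z)} = card ({..<Suc (nat_of_str y)} \<inter> {m. P m})"
    by (metis card_image inj_on_subset bij_is_inj[OF bij_nat_of_str] subset_UNIV)
  then show ?thesis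
    by (simp add: rank_of_def sum_of_bool_eq del: sum.lessThan_Suc)
qed

definition diag_set :: "(nat \<Rightarrow> bool) \<Rightarrow> bitstring set" where
  "diag_set c = {x. block_mem c (nat_of_str x)}"

text \<open>The terms count the earlier blocks, \<open>4 * n + 1\<close> itself, and
  \<open>4 * n\<close> if it was chosen.\<close>

lemma rank_of_diag_set:
  assumes "nat_of_str t = 4 * n + 1"
  shows "t \<in> diag_set c" "rank_of (diag_set c) t = 2 * n + 1 + of_bool (c n)"
  using assms by (simp_all add: diag_set_def rank_of_numbered count_block_mem)

lemma rank_of_Compl_diag_set:
  assumes "nat_of_str t = 4 * n + 2"
  shows "t \<in> - diag_set c" "rank_of (- diag_set c) t = 2 * n + 1 + of_bool (\<not> c n)"
proof -
  have Compl: "- diag_set c = {x. \<not> block_mem c (nat_of_str x)}"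
    by (auto simp: diag_set_def)
  show "t \<in> - diag_set c" "rank_of (- diag_set c) t = 2 * n + 1 + of_bool (\<not> c n)"
    using assms
    by (simp_all add: Compl rank_of_numbered[of "\<lambda>m. \<not> block_mem c m"] count_block_mem)
qed

lemma not_P_rankableI:
  assumes "\<And>f. polytime_computable f \<Longrightarrow> \<exists>x\<in>A. nat_of_str (f x) \<noteq> rank_of A x"
  shows "\<not> P_rankable A"
  using assms by (fastforce simp: P_rankable_def ranking_function_def)

theorem theorem26:
  shows "\<exists>A B :: bitstring set.
    \<not> P_rankable A \<and> \<not> P_rankable B \<and> P_rankable (set_join A B)"
proof -
  define F where "F = from_nat_into {f. polytime_computable f}"
  have F: "\<exists>i. f = F i" if "polytime_computable f" for f
    using subset_range_from_nat_into[OF countable_polytime_computable] that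
    by (auto simp: F_def)
  define str where "str = inv nat_of_str"
  have str: "nat_of_str (str m) = m" for m
    by (simp add: str_def surj_f_inv_f bij_is_surj[OF bij_nat_of_str])
  text \<open>
    Block \<open>2i\<close> defeats \<open>F i\<close> on \<open>A\<close>, block \<open>2i + 1\<close> defeats \<open>F i\<close> on the complement.
  \<close>
  define c where "c n \<longleftrightarrow>
    (if even n then nat_of_str (F (n div 2) (str (4 * n + 1))) = 2 * n + 1
     else nat_of_str (F (n div 2) (str (4 * n + 2))) \<noteq> 2 * n + 1)" for n
  define A where "A = diag_set c"
  have "\<not> P_rankable A"
  proof (rule not_P_rankableI)
    fix f assume "polytime_computable f"
    then obtain i where "f = F i" using F by blast
    \<comment> \<open>If \<open>c (2 * i)\<close> holds, the value is \<open>2 * (2 * i) + 1\<close>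
      and the rank is one more; otherwise the rank is that number and the value is not.\<close>
    then have "nat_of_str (f (str (4 * (2 * i) + 1))) \<noteq> 2 * (2 * i) + 1 + of_bool (c (2 * i))"
      by (simp add: c_def)
    then show "\<exists>x\<in>A. nat_of_str (f x) \<noteq> rank_of A x"
      unfolding A_def by (metis rank_of_diag_set str)
  qed
  moreover have "\<not> P_rankable (- A)"
  proof (rule not_P_rankableI)
    fix f assume "polytime_computable f"
    then obtain i where "f = F i" using F by blast
    \<comment> \<open>In the complement the rank is the larger one exactly when \<open>c\<close>
      fails, hence the negated test in \<open>c\<close> at odd arguments.\<close>
    then have "nat_of_str (f (str (4 * (2 * i + 1) + 2))) \<noteq>
        2 * (2 * i + 1) + 1 + of_bool (\<not> c (2 * i + 1))"
      by (simp add: c_def)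
    then show "\<exists>x\<in>- A. nat_of_str (f x) \<noteq> rank_of (- A) x"
      unfolding A_def by (metis rank_of_Compl_diag_set str)
  qed
  ultimately show ?thesis
    using P_rankable_set_join_Compl by blast
qed

end
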